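(* Let $R$ be a valuative semifield and let $I$ be a homogeneous tropical ideal in $R[x_0,\dots,x_n]$. Then its Hilbert function $H_I$ is eventually polynomial; that is, there is a polynomial $P$ such that $H_I(d)=P(d)$ for all sufficiently large $d$.
   Context: Valuative semifield: a semifield $(R,\oplus,\odot)$ with additive identity denoted $\infty$, such that $R^*=R\setminus\{\infty\}$ is a totally ordered group under $\odot$ and $a\oplus b=\min(a,b)$, where the order is extended to $R$ by making $\infty$ the largest element. $R[x_0,\dots,x_n]$ is the semiring of formal polynomials. An ideal of a semiring is a nonempty subset closed under addition and under multiplication by elements of the semiring. Valuated matroids: a valuated matroid of rank $r$ on a finite set $E$ with values in $R$ is $\mathcal M=(E,p)$ with $p:\binom{E}{r}\to R$ not identically $\infty$, such that for all $A,B\in\binom Er$ and $a\in A\setminus B$ there is $b\in B\setminus A$ with $p(A)\odot p(B)\ge p(A\cup b-a)\odot p(B\cup a-b)$; $p$ and $\lambda\odot p$ ($\lambda\in R^*$) define the same valuated matroid. The sets $B$ with $p(B)\ne\infty$ are the bases of the underlying matroid $\underline{\mathcal M}$. For a basis $B$ of $\underline{\mathcal M}$ and $e\in E\setminus B$, the fundamental circuit $H(B,e)\in R^E$ has coordinates $H(B,e)_{e'}=p(B\cup e-e')/p(B)$ (with $p$ of a set of size $>r$ taken to be $\infty$). Circuits are the vectors $\lambda\odot H(B,e)$ with $\lambda\in R^*$. The set of vectors $\mathcal V(\mathcal M)$ is the $R$-subsemimodule of $R^E$ generated by the circuits. Homogeneous tropical ideals: let $\mathrm{Mon}_d$ be the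 set of monomials of degree $d$ in $x_0,\dots,x_n$, and identify $R^{\mathrm{Mon}_d}$ with the homogeneous polynomials of degree $d$. A homogeneous ideal $I\subseteq R[x_0,\dots,x_n]$ is a homogeneous tropical ideal if for each $d\ge0$ its degree-$d$ part $I_d$ equals $\mathcal V(\mathcal M_d(I))$ for a valuated matroid $\mathcal M_d(I)$ on $\mathrm{Mon}_d$. Hilbert function: $H_I(d)=\mathrm{rank}(\mathcal M_d(I))$ for $d\in\mathbb Z_{\ge0}$. *)

theory Defs
  imports
    Complex_Main
    "HOL-Library.Poly_Mapping"
    "HOL-Computational_Algebra.Polynomial"
begin

text \<open>
  The tropical operations are written in ring notation: \<open>a + b\<close> is the minimum of \<open>a\<close> and \<open>b\<close>,
  \<open>a * b\<close> is the group operation, \<open>0\<close> is the element at infinity (the additive identity, hence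
  the \<^emph>\<open>largest\<close> element of the order) and \<open>1\<close> is the identity of the group of nonzero elements.
  The value of \<open>inverse 0\<close> is left unspecified.
\<close>

class valuative_semifield = comm_semiring_1 + inverse + linorder +
  assumes semifield_left_inverse: "a \<noteq> 0 \<Longrightarrow> inverse a * a = 1"
    and semifield_divide_inverse: "a / b = a * inverse b"
    and add_eq_min: "a + b = min a b"
    and le_infinity: "a \<le> 0"
    and translation_mono: "\<lbrakk>a \<noteq> 0; b \<noteq> 0; c \<noteq> 0; a \<le> b\<rbrakk> \<Longrightarrow> c * a \<le> c * b"

text \<open>
  The basis valuation \<open>p\<close> on \<open>r\<close>-subsets of \<open>E\<close> is extended by infinity to all sets.
\<close>

definition valuated_matroid ::
  "'e set \<Rightarrow> nat \<Rightarrow> ('e set \<Rightarrow> 'r::valuative_semifield) \<Rightarrow> bool" where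
  "valuated_matroid E r p \<longleftrightarrow>
     finite E \<and>
     (\<forall>A. p A \<noteq> 0 \<longrightarrow> A \<subseteq> E \<and> card A = r) \<and>
     (\<exists>A. p A \<noteq> 0) \<and>
     (\<forall>A B. A \<subseteq> E \<and> card A = r \<and> B \<subseteq> E \<and> card B = r \<longrightarrow>
        (\<forall>a\<in>A - B. \<exists>b\<in>B - A.
           p A * p B \<ge> p (insert b A - {a}) * p (insert a B - {b})))"

text \<open>
  Vectors in \<open>R\<^sup>E\<close> are functions that are \<open>0\<close> (infinity) off \<open>E\<close>. For \<open>e'\<close> outside
  \<open>insert e B\<close> the set below has more than \<open>r\<close> elements, so that the coordinate is \<open>0\<close>.
\<close>

definition fundamental_circuit ::
  "('e set \<Rightarrow> 'r::valuative_semifield) \<Rightarrow> 'e set \<Rightarrow> 'e \<Rightarrow> ('e \<Rightarrow> 'r)" where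
  "fundamental_circuit p B e = (\<lambda>e'. p (insert e B - {e'}) / p B)"

definition circuits :: "'e set \<Rightarrow> ('e set \<Rightarrow> 'r::valuative_semifield) \<Rightarrow> ('e \<Rightarrow> 'r) set" where
  "circuits E p =
     {(\<lambda>e'. c * fundamental_circuit p B e e') | c B e. c \<noteq> 0 \<and> p B \<noteq> 0 \<and> e \<in> E - B}"

definition subsemimodule :: "('e \<Rightarrow> 'r::comm_semiring_1) set \<Rightarrow> bool" where
  "subsemimodule S \<longleftrightarrow>
     (\<lambda>_. 0) \<in> S \<and>
     (\<forall>u\<in>S. \<forall>v\<in>S. (\<lambda>e. u e + v e) \<in> S) \<and>
     (\<forall>c. \<forall>v\<in>S. (\<lambda>e. c * v e) \<in> S)"

definition vectors :: "'e set \<Rightarrow> ('e set \<Rightarrow> 'r::valuative_semifield) \<Rightarrow> ('e \<Rightarrow> 'r) set" where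
  "vectors E p = subsemimodule hull circuits E p"

text \<open>
  Monomials are exponent vectors \<open>nat \<Rightarrow>\<^sub>0 nat\<close>, and formal polynomials are finitely supported
  functions from monomials to coefficients. The variables of \<open>R[x_0,\<dots>,x_n]\<close> are
  those with index at most \<open>n\<close>.
\<close>

type_synonym monomial = "nat \<Rightarrow>\<^sub>0 nat"
type_synonym 'r mpolynomial = "monomial \<Rightarrow>\<^sub>0 'r"

definition monom_degree :: "monomial \<Rightarrow> nat" where
  "monom_degree m = (\<Sum>i\<in>Poly_Mapping.keys m. Poly_Mapping.lookup m i)"

definition monomials :: "nat \<Rightarrow> nat \<Rightarrow> monomial set" where
  "monomials n d = {m. Poly_Mapping.keys m \<subseteq> {0..n} \<and> monom_degree m = d}"

definition polynomials :: "nat \<Rightarrow> 'r::zero mpolynomial set" where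
  "polynomials n = {f. \<forall>m\<in>Poly_Mapping.keys f. Poly_Mapping.keys m \<subseteq> {0..n}}"

definition polynomial_ideal :: "nat \<Rightarrow> 'r::comm_semiring_1 mpolynomial set \<Rightarrow> bool" where
  "polynomial_ideal n I \<longleftrightarrow>
     I \<subseteq> polynomials n \<and> I \<noteq> {} \<and>
     (\<forall>f\<in>I. \<forall>g\<in>I. f + g \<in> I) \<and>
     (\<forall>f\<in>I. \<forall>h\<in>polynomials n. h * f \<in> I)"

definition homogeneous_component ::
  "nat \<Rightarrow> 'r::comm_semiring_1 mpolynomial \<Rightarrow> 'r mpolynomial" where
  "homogeneous_component d f =
     (\<Sum>m\<in>{m\<in>Poly_Mapping.keys f. monom_degree m = d}.
        Poly_Mapping.single m (Poly_Mapping.lookup f m))"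

definition homogeneous_ideal :: "nat \<Rightarrow> 'r::comm_semiring_1 mpolynomial set \<Rightarrow> bool" where
  "homogeneous_ideal n I \<longleftrightarrow>
     polynomial_ideal n I \<and> (\<forall>f\<in>I. \<forall>d. homogeneous_component d f \<in> I)"

definition degree_part :: "'r::zero mpolynomial set \<Rightarrow> nat \<Rightarrow> 'r mpolynomial set" where
  "degree_part I d = {f\<in>I. \<forall>m\<in>Poly_Mapping.keys f. monom_degree m = d}"

text \<open>
  The valuated matroid \<open>p\<close> of rank \<open>r\<close> on the monomials of degree \<open>d\<close> represents the degree \<open>d\<close>
  part of \<open>I\<close>; homogeneous polynomials are identified with their coefficient vectors.
\<close>

definition degree_matroid ::
  "nat \<Rightarrow> 'r::valuative_semifield mpolynomial set \<Rightarrow> nat \<Rightarrow> nat \<Rightarrow> (monomial set \<Rightarrow> 'r) \<Rightarrow> bool"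
  where
  "degree_matroid n I d r p \<longleftrightarrow>
     valuated_matroid (monomials n d) r p \<and>
     Poly_Mapping.lookup ` degree_part I d = vectors (monomials n d) p"

definition homogeneous_tropical_ideal ::
  "nat \<Rightarrow> 'r::valuative_semifield mpolynomial set \<Rightarrow> bool" where
  "homogeneous_tropical_ideal n I \<longleftrightarrow>
     homogeneous_ideal n I \<and> (\<forall>d. \<exists>r p. degree_matroid n I d r p)"

text \<open>
  The rank is well defined for homogeneous tropical ideals: it is the maximal size of a set of
  monomials of degree \<open>d\<close> that contains the support of no nonzero element of \<open>degree_part I d\<close>.
\<close>

definition hilbert_function ::
  "nat \<Rightarrow> 'r::valuative_semifield mpolynomial set \<Rightarrow> nat \<Rightarrow> nat" where
  "hilbert_function n I d = (THE r. \<exists>p. degree_matroid n I d r p)"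

end

theory Submission
  imports Defs
begin

text \<open>
  Fix a monomial order. In a matroid on an ordered ground set, the elements that are not the
  maximum of any circuit form the greedy basis, so the Hilbert function counts the monomials that
  are not leading monomials of elements of \<open>I\<close>. The leading monomials are closed under
  multiplication, as for ideals over a field, and the complement of such a set is counted by an
  eventually polynomial function: slice by the exponent of one variable; the slices increase and
  are eventually constant by Dickson's lemma, so that induction on the number of variables applies.
\<close>

section \<open>Eventually polynomial functions\<close>

text \<open>Rational coefficients are essential: an integer-valued polynomial such as d(d+1)/2 need
  not have integer coefficients.\<close>

definition eventually_poly :: "(nat \<Rightarrow> nat) \<Rightarrow> bool" where
  "eventually_poly f \<longleftrightarrow>
     (\<exists>P :: rat poly. \<forall>\<^sub>F d in sequentially. of_nat (f d) = poly P (of_nat d))"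

lemma eventually_polyE:
  assumes "eventually_poly f"
  obtains P :: "rat poly" and N where "\<And>d. d \<ge> N \<Longrightarrow> of_nat (f d) = poly P (of_nat d)"
  using assms unfolding eventually_poly_def eventually_sequentially by blast

lemma eventually_polyI:
  fixes P :: "rat poly"
  assumes "\<And>d. d \<ge> N \<Longrightarrow> of_nat (f d) = poly P (of_nat d)"
  shows "eventually_poly f"
  using assms unfolding eventually_poly_def eventually_sequentially by blast

lemma eventually_poly_add:
  assumes "eventually_poly f" "eventually_poly g"
  shows "eventually_poly (\<lambda>d. f d + g d)"
proof -
  obtain P :: "rat poly" and M where P: "\<And>d. d \<ge> M \<Longrightarrow> of_nat (f d) = poly P (of_nat d)"
    using eventually_polyE[OF assms(1)] by blast
  obtain Q :: "rat poly" and N where Q: "\<And>d. d \<ge> N \<Longrightarrow> of_nat (g d) = poly Q (of_nat d)"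
    using eventually_polyE[OF assms(2)] by blast
  show ?thesis
    by (rule eventually_polyI[of "max M N" _ "P + Q"]) (simp add: P Q)
qed

lemma eventually_poly_sum:
  assumes "finite A" "\<And>j. j \<in> A \<Longrightarrow> eventually_poly (f j)"
  shows "eventually_poly (\<lambda>d. \<Sum>j\<in>A. f j d)"
  using assms
proof (induction A rule: finite_induct)
  case empty
  show ?case by (rule eventually_polyI[of 0 _ 0]) simp
next
  case (insert a A)
  then show ?case using eventually_poly_add[of "f a" "\<lambda>d. \<Sum>j\<in>A. f j d"] by simp
qed

lemma eventually_poly_shift:
  assumes "eventually_poly f"
  shows "eventually_poly (\<lambda>d. f (d - j))"
proof -
  obtain P :: "rat poly" and N where P: "\<And>d. d \<ge> N \<Longrightarrow> of_nat (f d) = poly P (of_nat d)"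
    using eventually_polyE[OF assms] by blast
  \<comment> \<open>From \<open>N + j\<close> on, the truncated difference \<open>d - j\<close> is a
    true one and is at least \<open>N\<close>.\<close>
  show ?thesis
    by (rule eventually_polyI[of "N + j" _ "pcompose P [:- of_nat j, 1:]"])
      (simp add: P poly_pcompose of_nat_diff)
qed

lemma eventually_poly_cong:
  assumes "eventually_poly f" "\<And>d. d \<ge> N \<Longrightarrow> g d = f d"
  shows "eventually_poly g"
proof -
  obtain P :: "rat poly" and M where P: "\<And>d. d \<ge> M \<Longrightarrow> of_nat (f d) = poly P (of_nat d)"
    using eventually_polyE[OF assms(1)] by blast
  show ?thesis
    by (rule eventually_polyI[of "max M N" _ P]) (simp add: P assms(2))
qed

text \<open>Telescoping the differences of consecutive (k+1)-st powers and expanding them binomially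
  gives a linear relation between the power sums of exponents up to k. The k-th one has coefficient
  k+1, which is invertible in characteristic 0, so the relation can be solved for it.\<close>

lemma sum_of_powers_poly:
  "\<exists>Q :: 'a::field_char_0 poly. \<forall>m. (\<Sum>i<m. of_nat i ^ k) = poly Q (of_nat m)"
proof (induction k rule: less_induct)
  case (less k)
  then obtain S :: "nat \<Rightarrow> 'a poly"
    where S: "\<And>j m. j < k \<Longrightarrow> (\<Sum>i<m. of_nat i ^ j) = poly (S j) (of_nat m)"
    by metis
  define Q where "Q = smult (inverse (of_nat (Suc k)))
    (monom 1 (Suc k) - (\<Sum>j<k. smult (of_nat (Suc k choose j)) (S j)))"
  have "(\<Sum>i<m. of_nat i ^ k) = poly Q (of_nat m)" for m
  proof -
    have "of_nat m ^ Suc k = (\<Sum>i<m. of_nat (Suc i) ^ Suc k - of_nat i ^ Suc k :: 'a)"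
      by (subst sum_lessThan_telescope) simp
    also have "\<dots> = (\<Sum>i<m. \<Sum>j\<le>k. of_nat (Suc k choose j) * of_nat i ^ j)"
    proof (rule sum.cong[OF refl])
      fix i
      have "of_nat (Suc i) ^ Suc k = (of_nat i + 1 :: 'a) ^ Suc k"
        by (simp add: add.commute)
      also have "\<dots> = (\<Sum>j\<le>Suc k. of_nat (Suc k choose j) * of_nat i ^ j)"
        by (subst binomial_ring) simp
      finally show "of_nat (Suc i) ^ Suc k - of_nat i ^ Suc k =
          (\<Sum>j\<le>k. of_nat (Suc k choose j) * of_nat i ^ j :: 'a)"
        by (simp del: power_Suc binomial_Suc_Suc)
    qed
    also have "\<dots> = (\<Sum>j\<le>k. of_nat (Suc k choose j) * (\<Sum>i<m. of_nat i ^ j))"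
      by (subst sum.swap) (simp add: sum_distrib_left)
    also have "\<dots> = (\<Sum>j<k. of_nat (Suc k choose j) * poly (S j) (of_nat m))
        + of_nat (Suc k) * (\<Sum>i<m. of_nat i ^ k)"
      using S by (simp add: lessThan_Suc_atMost[symmetric] del: binomial_Suc_Suc of_nat_Suc)
    finally have "of_nat (Suc k) * (\<Sum>i<m. of_nat i ^ k) =
        of_nat m ^ Suc k - (\<Sum>j<k. of_nat (Suc k choose j) * poly (S j) (of_nat m) :: 'a)"
      by simp
    then have "(\<Sum>i<m. of_nat i ^ k) = inverse (of_nat (Suc k)) *
        (of_nat m ^ Suc k - (\<Sum>j<k. of_nat (Suc k choose j) * poly (S j) (of_nat m) :: 'a))"
      by (metis of_nat_eq_0_iff left_inverse mult.assoc mult_1 nat.distinct(1))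
    then show ?thesis
      by (simp add: Q_def poly_monom poly_sum del: binomial_Suc_Suc of_nat_Suc)
  qed
  then show ?case by blast
qed

lemma sum_poly_values_poly:
  fixes P :: "'a::field_char_0 poly"
  shows "\<exists>Q. \<forall>m. (\<Sum>i<m. poly P (of_nat i)) = poly Q (of_nat m)"
proof -
  obtain S :: "nat \<Rightarrow> 'a poly" where S: "\<And>k m. (\<Sum>i<m. of_nat i ^ k) = poly (S k) (of_nat m)"
    using sum_of_powers_poly by metis
  have "(\<Sum>i<m. poly P (of_nat i)) =
      poly (\<Sum>k\<le>degree P. smult (coeff P k) (S k)) (of_nat m)" for m
  proof -
    have "(\<Sum>i<m. poly P (of_nat i)) = (\<Sum>k\<le>degree P. coeff P k * (\<Sum>i<m. of_nat i ^ k))"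
      by (simp add: poly_altdef sum_distrib_left sum.swap[of _ _ "{..<m}"])
    then show ?thesis by (simp add: S poly_sum)
  qed
  then show ?thesis by blast
qed

lemma eventually_poly_partial_sums:
  assumes "eventually_poly f"
  shows "eventually_poly (\<lambda>d. \<Sum>i\<le>d. f i)"
proof -
  obtain P :: "rat poly" and N where P: "\<And>d. d \<ge> N \<Longrightarrow> of_nat (f d) = poly P (of_nat d)"
    using eventually_polyE[OF assms] by blast
  obtain Q where Q: "\<And>m. (\<Sum>i<m. poly P (of_nat i)) = poly Q (of_nat m)"
    using sum_poly_values_poly by metis
  \<comment> \<open>The constant \<open>c\<close> corrects the finitely many values below
    \<open>N\<close>, where \<open>f\<close> may differ from \<open>P\<close>.\<close>
  define c where "c = (\<Sum>i<N. of_nat (f i) - poly P (of_nat i))"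
  show ?thesis
  \<comment> \<open>\<open>Q\<close> gives the sum of the first m values, and the sum up to and
    including \<open>d\<close> has d+1 terms; hence the substitution of 1 + X.\<close>
  proof (rule eventually_polyI[of N _ "[:c:] + pcompose Q [:1, 1:]"])
    fix d assume "N \<le> d"
    have "of_nat (\<Sum>i\<le>d. f i) - (\<Sum>i<Suc d. poly P (of_nat i)) =
        (\<Sum>i<Suc d. of_nat (f i) - poly P (of_nat i))"
      by (simp only: sum_subtractf of_nat_sum lessThan_Suc_atMost)
    also have "\<dots> = c"
      unfolding c_def using \<open>N \<le> d\<close> P by (intro sum.mono_neutral_right) auto
    finally show "of_nat (\<Sum>i\<le>d. f i) = poly ([:c:] + pcompose Q [:1, 1:]) (of_nat d)"
      unfolding Q by (simp add: poly_pcompose algebra_simps)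
  qed
qed

section \<open>Up-closed sets of exponent vectors\<close>

text \<open>These are the exponent sets of monomial ideals in \<open>k\<close> variables. Lists of
  fixed length make the removal of a variable the removal of the head, which suits induction on
  \<open>k\<close>.\<close>

definition up_closed :: "nat \<Rightarrow> nat list set \<Rightarrow> bool" where
  "up_closed k L \<longleftrightarrow> L \<subseteq> {xs. length xs = k} \<and>
     (\<forall>xs\<in>L. \<forall>ys. list_all2 (\<le>) xs ys \<longrightarrow> ys \<in> L)"

definition slice :: "nat \<Rightarrow> nat list set \<Rightarrow> nat list set" where
  "slice j L = {xs. j # xs \<in> L}"

lemma up_closed_slice: "up_closed (Suc k) L \<Longrightarrow> up_closed k (slice j L)"
  unfolding up_closed_def slice_def by auto

lemma slice_mono:
  assumes "up_closed k L" "i \<le> j"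
  shows "slice i L \<subseteq> slice j L"
proof
  fix xs assume "xs \<in> slice i L"
  moreover have "list_all2 (\<le>) (i # xs) (j # xs)"
    using \<open>i \<le> j\<close> by (simp add: list_all2_refl)
  ultimately show "xs \<in> slice j L"
    using assms(1) unfolding up_closed_def slice_def by blast
qed

lemma slice_subset: "L \<subseteq> M \<Longrightarrow> slice j L \<subseteq> slice j M"
  by (auto simp: slice_def)

lemma eq_if_slices_eq:
  assumes "up_closed (Suc k) L" "up_closed (Suc k) M" "\<And>j. slice j L = slice j M"
  shows "L = M"
proof (rule set_eqI)
  fix xs
  show "xs \<in> L \<longleftrightarrow> xs \<in> M"
  proof (cases xs)
    case Nil
    then show ?thesis using assms(1,2) by (auto simp: up_closed_def)
  next
    case (Cons j ys)
    then show ?thesis using assms(3)[of j] by (auto simp: slice_def)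
  qed
qed

text \<open>Dickson's lemma, as an ascending chain condition.\<close>

lemma up_closed_chain_stabilizes:
  fixes F :: "nat \<Rightarrow> nat list set"
  assumes "\<And>i. up_closed k (F i)" "mono F"
  shows "\<exists>N. \<forall>i\<ge>N. F i = F N"
  using assms
proof (induction k arbitrary: F)
  case 0
  then have sub: "F i \<subseteq> {[]}" for i by (auto simp: up_closed_def)
  show ?case
  proof (cases "\<exists>N. [] \<in> F N")
    case True
    then obtain N where "[] \<in> F N" by blast
    then have "F i = F N" if "i \<ge> N" for i
      using sub monoD[OF \<open>mono F\<close> that] by blast
    then show ?thesis by blast
  next
    case False
    then have "F i = {}" for i using sub by blast
    then show ?thesis by simp
  qed
next
  case (Suc k)
  have slice_mono2: "slice i (F a) \<subseteq> slice j (F b)" if "i \<le> j" "a \<le> b" for i j a b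
    using slice_mono[OF Suc.prems(1) that(1)] slice_subset[OF monoD[OF \<open>mono F\<close> that(2)]] by blast
  \<comment> \<open>The diagonal slices form an ascending chain in one variable fewer. The stage
    \<open>D\<close> from which it is constant controls all slices with \<open>j\<close> at least
    \<open>D\<close> at once.\<close>
  have "\<exists>N. \<forall>i\<ge>N. slice i (F i) = slice N (F N)"
    by (rule Suc.IH) (auto intro: up_closed_slice Suc.prems monoI slice_mono2[THEN subsetD])
  then obtain D where D: "\<And>i. i \<ge> D \<Longrightarrow> slice i (F i) = slice D (F D)" by blast
  have "\<exists>N. \<forall>i\<ge>N. slice j (F i) = slice j (F N)" for j
    by (rule Suc.IH) (auto intro: up_closed_slice Suc.prems monoI slice_mono2[THEN subsetD])
  then obtain g where g: "\<And>j i. i \<ge> g j \<Longrightarrow> slice j (F i) = slice j (F (g j))" by metis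
  \<comment> \<open>Only finitely many \<open>j\<close> lie below \<open>D\<close>. For each of them
    the chain of \<open>j\<close>-th slices is constant from \<open>g j\<close> on, so
    \<open>N\<close> is taken beyond all these stages.\<close>
  define N where "N = Max (insert D (g ` {..<D}))"
  have gN: "g j \<le> N" if "j < D" for j
    using that unfolding N_def by auto
  have "D \<le> N" unfolding N_def by auto
  have "F i = F N" if "i \<ge> N" for i
  proof (rule eq_if_slices_eq[OF Suc.prems(1) Suc.prems(1)])
    fix j
    show "slice j (F i) = slice j (F N)"
    proof (cases "j < D")
      case True
      then show ?thesis using g[of j i] g[of j N] gN[of j] that by simp
    next
      case False
      \<comment> \<open>With \<open>i\<close> and \<open>j\<close> both at least \<open>D\<close>,
        the slice is squeezed between the diagonal slices at \<open>D\<close> and at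
        \<open>max i j\<close>, which coincide.\<close>
      have *: "slice j (F i) = slice D (F D)" if "i \<ge> D" for i
      proof
        show "slice D (F D) \<subseteq> slice j (F i)"
          using False that by (intro slice_mono2) auto
        have "slice j (F i) \<subseteq> slice (max i j) (F (max i j))"
          by (intro slice_mono2) auto
        then show "slice j (F i) \<subseteq> slice D (F D)" using D[of "max i j"] that by auto
      qed
      show ?thesis using *[of i] *[of N] \<open>D \<le> N\<close> that by auto
    qed
  qed
  then show ?case by blast
qed

text \<open>The standard monomials of degree \<open>d\<close>; their number is the Hilbert function
  of the quotient by the monomial ideal with exponent set \<open>L\<close>.\<close>

definition gaps :: "nat \<Rightarrow> nat list set \<Rightarrow> nat \<Rightarrow> nat list set" where
  "gaps k L d = {xs. length xs = k \<and> sum_list xs = d \<and> xs \<notin> L}"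

lemma finite_gaps: "finite (gaps k L d)"
proof (rule finite_subset)
  show "gaps k L d \<subseteq> {xs. set xs \<subseteq> {..d} \<and> length xs = k}"
    by (auto simp: gaps_def member_le_sum_list)
qed (simp add: finite_lists_length_eq)

lemma card_gaps_Suc: "card (gaps (Suc k) L d) = (\<Sum>j\<le>d. card (gaps k (slice j L) (d - j)))"
proof -
  have "gaps (Suc k) L d = (\<Union>j\<in>{..d}. (#) j ` gaps k (slice j L) (d - j))"
    by (auto simp: gaps_def slice_def length_Suc_conv image_iff)
  then have "card (gaps (Suc k) L d) = (\<Sum>j\<le>d. card ((#) j ` gaps k (slice j L) (d - j)))"
    by (simp only:) (rule card_UN_disjoint, auto simp: finite_gaps)
  then show ?thesis by (simp add: card_image)
qed

lemma eventually_poly_card_gaps: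
  assumes "up_closed k L"
  shows "eventually_poly (\<lambda>d. card (gaps k L d))"
  using assms
proof (induction k arbitrary: L)
  case 0
  have "gaps 0 L d = {}" if "d \<ge> 1" for d
    using that by (auto simp: gaps_def)
  then show ?case by (intro eventually_polyI[of 1 _ 0]) simp
next
  case (Suc k)
  have slices: "up_closed k (slice j L)" for j
    by (rule up_closed_slice[OF Suc.prems])
  have "mono (\<lambda>j. slice j L)"
    by (rule monoI) (rule slice_mono[OF Suc.prems])
  then obtain J where J: "\<And>j. j \<ge> J \<Longrightarrow> slice j L = slice J L"
    using up_closed_chain_stabilizes[of k "\<lambda>j. slice j L"] slices by blast
  let ?h = "\<lambda>j d. card (gaps k (slice j L) d)"
  have IH: "eventually_poly (?h j)" for j
    by (rule Suc.IH[OF slices])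
  \<comment> \<open>Below \<open>J\<close> there are finitely many different slices, each
    contributing a shifted count. From \<open>J\<close> on all slices agree, and the substitution i
    = d - j turns their contributions into a partial sum.\<close>
  have "card (gaps (Suc k) L d) = (\<Sum>j<J. ?h j (d - j)) + (\<Sum>i\<le>d - J. ?h J i)" if "d \<ge> J" for d
  proof -
    have "card (gaps (Suc k) L d) = (\<Sum>j<J. ?h j (d - j)) + (\<Sum>j=J..d. ?h j (d - j))"
      unfolding card_gaps_Suc using that
      by (subst sum.union_disjoint[symmetric]) (auto intro!: sum.cong)
    also have "(\<Sum>j=J..d. ?h j (d - j)) = (\<Sum>j=J..d. ?h J (d - j))"
    proof (rule sum.cong[OF refl])
      fix j assume "j \<in> {J..d}"
      then have "slice j L = slice J L" by (intro J) simp
      then show "?h j (d - j) = ?h J (d - j)" by (rule arg_cong)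
    qed
    also have "\<dots> = (\<Sum>i\<le>d - J. ?h J i)"
      using that
      by (intro sum.reindex_bij_witness[of _ "\<lambda>i. d - i" "\<lambda>j. d - j"]) auto
    finally show ?thesis .
  qed
  moreover have "eventually_poly (\<lambda>d. (\<Sum>j<J. ?h j (d - j)) + (\<Sum>i\<le>d - J. ?h J i))"
    by (intro eventually_poly_add eventually_poly_sum
        eventually_poly_shift[OF IH] eventually_poly_shift[OF eventually_poly_partial_sums[OF IH]])
      simp
  ultimately show ?case by (rule eventually_poly_cong[rotated])
qed

section \<open>Valuative semifields and valuated matroids\<close>

lemma semifield_mult_eq_0_iff:
  fixes a b :: "'r::valuative_semifield"
  shows "a * b = 0 \<longleftrightarrow> a = 0 \<or> b = 0"
proof
  assume "a * b = 0"
  show "a = 0 \<or> b = 0"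
  proof (rule disjCI)
    assume "b \<noteq> 0"
    then have "a = a * b * inverse b"
      using semifield_left_inverse[of b] by (simp add: mult.assoc mult.commute[of b])
    then show "a = 0" using \<open>a * b = 0\<close> by simp
  qed
qed auto

lemma semifield_divide_eq_0_iff:
  fixes a b :: "'r::valuative_semifield"
  assumes "b \<noteq> 0"
  shows "a / b = 0 \<longleftrightarrow> a = 0"
proof -
  have "inverse b \<noteq> 0"
    using semifield_left_inverse[OF assms] by auto
  then show ?thesis
    by (simp add: semifield_divide_inverse semifield_mult_eq_0_iff)
qed

text \<open>There is no cancellation, since \<open>0\<close> is the largest element and addition is
  the minimum. Hence the support of a sum of vectors is the union of their supports.\<close>

lemma semifield_add_eq_0_iff:
  fixes a b :: "'r::valuative_semifield"
  shows "a + b = 0 \<longleftrightarrow> a = 0 \<and> b = 0"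
  using le_infinity[of a] le_infinity[of b] by (auto simp: add_eq_min min_def split: if_splits)

text \<open>For coefficient vectors of polynomials these are the leading monomials; the definition
  makes sense for any linearly ordered index set.\<close>

definition leading :: "('e::linorder \<Rightarrow> 'r::zero) set \<Rightarrow> 'e set" where
  "leading V = {e. \<exists>v\<in>V. v e \<noteq> 0 \<and> (\<forall>e'. v e' \<noteq> 0 \<longrightarrow> e' \<le> e)}"

text \<open>The greedy basis \<open>B\<close> minimizes the sum of the positions of its elements in \<open>E\<close>.\<close>

lemma card_diff_leading_vectors:
  fixes p :: "'e::linorder set \<Rightarrow> 'r::valuative_semifield"
  assumes "valuated_matroid E r p"
  shows "card (E - leading (vectors E p)) = r"
proof -
  have "finite E" and basis: "\<And>A. p A \<noteq> 0 \<Longrightarrow> A \<subseteq> E \<and> card A = r" and ex: "\<exists>A. p A \<noteq> 0"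
    and exchange: "\<And>A B a. \<lbrakk>A \<subseteq> E; card A = r; B \<subseteq> E; card B = r; a \<in> A - B\<rbrakk> \<Longrightarrow>
      \<exists>b\<in>B - A. p A * p B \<ge> p (insert b A - {a}) * p (insert a B - {b})"
    using assms unfolding valuated_matroid_def by simp_all
  \<comment> \<open>Positions turn the order on \<open>E\<close> into natural weights, so that a
    basis of least total weight exists and replacing an element by a smaller one lowers the
    weight.\<close>
  define pos where "pos e = card {e'\<in>E. e' < e}" for e
  have pos_less: "pos e < pos e'" if "e < e'" "e \<in> E" for e e'
    unfolding pos_def using that \<open>finite E\<close> by (intro psubset_card_mono) auto
  obtain B where B: "p B \<noteq> 0" and B_min: "\<And>A. p A \<noteq> 0 \<Longrightarrow> sum pos B \<le> sum pos A"
    using ex_has_least_nat[of "\<lambda>A. p A \<noteq> 0" _ "sum pos"] ex by blast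
  have "B \<subseteq> E" "card B = r" using basis[OF B] by auto
  then have "finite B" using \<open>finite E\<close> finite_subset by blast
  have swap_le: "b \<le> e" if "p (insert e B - {b}) \<noteq> 0" "e \<in> E - B" "b \<in> B" for b e
  proof (rule ccontr)
    assume "\<not> b \<le> e"
    then have "pos e < pos b" using that by (intro pos_less) auto
    moreover have "sum pos (insert e B - {b}) + pos b = pos e + sum pos B"
      using that \<open>finite B\<close> sum.remove[of "insert e B" b pos] by simp
    ultimately show False using B_min[OF that(1)] by simp
  qed
  \<comment> \<open>The witness is the fundamental circuit of \<open>e\<close> over
    \<open>B\<close>: by \<open>swap_le\<close> no element of its support exceeds
    \<open>e\<close>.\<close>
  have leading_if_not_basis: "e \<in> leading (vectors E p)" if "e \<in> E - B" for e
  proof -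
    define v where "v = fundamental_circuit p B e"
    have supp: "v e' \<noteq> 0 \<longleftrightarrow> p (insert e B - {e'}) \<noteq> 0" for e'
      unfolding v_def fundamental_circuit_def using semifield_divide_eq_0_iff[OF B] by simp
    have "v \<in> circuits E p"
      unfolding circuits_def v_def using B that by (auto intro!: exI[of _ 1] exI[of _ B] exI[of _ e])
    then have "v \<in> vectors E p"
      unfolding vectors_def by (rule hull_inc)
    moreover have "v e \<noteq> 0"
      unfolding supp using B that by simp
    moreover have "e' \<le> e" if "v e' \<noteq> 0" for e'
    proof (cases "e' \<in> insert e B")
      case True
      then show ?thesis using swap_le \<open>v e' \<noteq> 0\<close> \<open>e \<in> E - B\<close> unfolding supp by auto
    next
      case False
      \<comment> \<open>Here nothing is removed, so the set has r+1 elements and \<open>p\<close>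
        would have to be infinite on it.\<close>
      then have "insert e B - {e'} = insert e B" by auto
      then have "card (insert e B) = r"
        using \<open>v e' \<noteq> 0\<close> basis unfolding supp by metis
      then show ?thesis using \<open>card B = r\<close> \<open>finite B\<close> \<open>e \<in> E - B\<close> by simp
    qed
    ultimately show ?thesis unfolding leading_def by blast
  qed
  \<comment> \<open>\<open>S\<close> consists of the vectors whose support has no maximum lying in
    \<open>B\<close>. The condition concerns supports only, so it survives sums and scaling; it
    remains to check it on circuits.\<close>
  define S where "S = {v :: 'e \<Rightarrow> 'r. \<forall>b\<in>B. v b \<noteq> 0 \<longrightarrow> (\<exists>e>b. v e \<noteq> 0)}"
  have "circuits E p \<subseteq> S"
  proof
    fix v assume "v \<in> circuits E p"
    then obtain c B' e where "c \<noteq> 0" "p B' \<noteq> 0" "e \<in> E - B'"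
      and v: "v = (\<lambda>e'. c * fundamental_circuit p B' e e')"
      unfolding circuits_def by blast
    have supp: "v e' \<noteq> 0 \<longleftrightarrow> p (insert e B' - {e'}) \<noteq> 0" for e'
      unfolding v fundamental_circuit_def using \<open>c \<noteq> 0\<close> \<open>p B' \<noteq> 0\<close>
      by (simp add: semifield_mult_eq_0_iff semifield_divide_eq_0_iff)
    have "\<exists>e'>b. v e' \<noteq> 0" if "b \<in> B" "v b \<noteq> 0" for b
    proof -
      \<comment> \<open>Since \<open>v b\<close> is finite, \<open>A\<close> is a basis, and it
        omits \<open>b\<close>. Exchanging \<open>b\<close> out of \<open>B\<close> against
        \<open>A\<close> yields the element \<open>c\<close> that will lie above \<open>b\<close> in
        the support of \<open>v\<close>.\<close>
      define A where "A = insert e B' - {b}"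
      have "p A \<noteq> 0" using that(2) unfolding supp A_def .
      then obtain c where c: "c \<in> A - B"
        and le: "p B * p A \<ge> p (insert c B - {b}) * p (insert b A - {c})"
        using exchange[of B A b] basis[of A] \<open>B \<subseteq> E\<close> \<open>card B = r\<close> \<open>b \<in> B\<close>
        unfolding A_def by blast
      \<comment> \<open>The product of \<open>p B\<close> and \<open>p A\<close> is finite and
        bounds this one from above, so both exchanged sets are bases as well.\<close>
      have "p (insert c B - {b}) * p (insert b A - {c}) \<noteq> 0"
        using le B \<open>p A \<noteq> 0\<close> le_infinity[of "p B * p A"] semifield_mult_eq_0_iff[of "p B" "p A"]
        by auto
      then have 1: "p (insert c B - {b}) \<noteq> 0" and 2: "p (insert b A - {c}) \<noteq> 0"
        unfolding semifield_mult_eq_0_iff by blast+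
      have "b \<in> insert e B'"
      proof (rule ccontr)
        assume "b \<notin> insert e B'"
        then have "p (insert e B') \<noteq> 0" using that(2) unfolding supp by simp
        then have "card (insert e B') = card B'" using basis \<open>p B' \<noteq> 0\<close> by metis
        moreover have "finite B'" using basis[OF \<open>p B' \<noteq> 0\<close>] \<open>finite E\<close> finite_subset by blast
        ultimately show False using \<open>e \<in> E - B'\<close> by simp
      qed
      \<comment> \<open>The second exchanged set is thus \<open>insert e B'\<close> without
        \<open>c\<close>, which puts \<open>c\<close> into the support of \<open>v\<close>. The
        first one gives \<open>b \<le> c\<close> by minimality of \<open>B\<close>, and
        \<open>c\<close> differs from \<open>b\<close> because it is not in
        \<open>B\<close>.\<close>
      then have "insert b A = insert e B'" unfolding A_def by auto
      then have "v c \<noteq> 0" using 2 unfolding supp by simp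
      moreover have "c \<in> E - B"
        using c basis[OF \<open>p A \<noteq> 0\<close>] by blast
      then have "b \<le> c" using swap_le[OF 1] \<open>b \<in> B\<close> by blast
      ultimately show ?thesis using c \<open>b \<in> B\<close> by (metis DiffE order_le_imp_less_or_eq)
    qed
    then show "v \<in> S" unfolding S_def by blast
  qed
  moreover have "subsemimodule S"
    unfolding subsemimodule_def S_def
    by (auto simp: semifield_add_eq_0_iff semifield_mult_eq_0_iff)
  ultimately have "vectors E p \<subseteq> S"
    unfolding vectors_def by (rule hull_minimal)
  then have "b \<notin> leading (vectors E p)" if "b \<in> B" for b
    using that unfolding leading_def S_def by (auto simp: not_le[symmetric])
  then have "E - leading (vectors E p) = B"
    using leading_if_not_basis \<open>B \<subseteq> E\<close> by blast
  then show ?thesis using \<open>card B = r\<close> by simp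
qed

section \<open>Leading monomials of a tropical ideal\<close>

text \<open>The right-hand side depends on \<open>I\<close> and \<open>d\<close> only, so every
  representing matroid has the same rank. This provides the uniqueness required by the definite
  description.\<close>

lemma hilbert_function_eq:
  assumes "homogeneous_tropical_ideal n I"
  shows "hilbert_function n I d =
    card (monomials n d - leading (Poly_Mapping.lookup ` degree_part I d))"
proof -
  have "r = card (monomials n d - leading (Poly_Mapping.lookup ` degree_part I d))"
    if "degree_matroid n I d r p" for r p
    using that card_diff_leading_vectors unfolding degree_matroid_def by metis
  then show ?thesis
    using assms unfolding hilbert_function_def homogeneous_tropical_ideal_def
    by (intro the_equality) metis+
qed

lemma lookup_single_mult:
  fixes f :: "'a::cancel_comm_monoid_add \<Rightarrow>\<^sub>0 'b::semiring_0"
  shows "Poly_Mapping.lookup (Poly_Mapping.single k c * f) (k + m) = c * Poly_Mapping.lookup f m"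
  by (simp add: lookup_mult lookup_single when_mult)

lemma keys_single_mult:
  fixes f :: "'a::cancel_comm_monoid_add \<Rightarrow>\<^sub>0 'b::semiring_0"
  shows "Poly_Mapping.keys (Poly_Mapping.single k c * f) \<subseteq> (+) k ` Poly_Mapping.keys f"
  using keys_mult[of "Poly_Mapping.single k c" f] by (auto split: if_splits)

lemma monom_degree_eq_sum:
  assumes "finite A" "Poly_Mapping.keys m \<subseteq> A"
  shows "monom_degree m = (\<Sum>i\<in>A. Poly_Mapping.lookup m i)"
  unfolding monom_degree_def using assms
  by (intro sum.mono_neutral_left) (auto simp: in_keys_iff)

lemma monom_degree_add: "monom_degree (k + m) = monom_degree k + monom_degree m"
proof -
  let ?A = "Poly_Mapping.keys k \<union> Poly_Mapping.keys m"
  have "monom_degree (k + m) = (\<Sum>i\<in>?A. Poly_Mapping.lookup (k + m) i)"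
    by (rule monom_degree_eq_sum) (use keys_add[of k m] in auto)
  moreover have "monom_degree k = (\<Sum>i\<in>?A. Poly_Mapping.lookup k i)"
    and "monom_degree m = (\<Sum>i\<in>?A. Poly_Mapping.lookup m i)"
    by (auto intro: monom_degree_eq_sum)
  ultimately show ?thesis by (simp add: lookup_add sum.distrib)
qed

text \<open>Multiplication by a monomial translates the support by \<open>k\<close>, and the linear
  order on monomials is compatible with addition, so the maximum of the support is translated
  too.\<close>

lemma leading_degree_part_add:
  fixes I :: "'r::valuative_semifield mpolynomial set"
  assumes "polynomial_ideal n I" "Poly_Mapping.keys k \<subseteq> {0..n}"
    and "m \<in> leading (Poly_Mapping.lookup ` degree_part I d)"
  shows "k + m \<in> leading (Poly_Mapping.lookup ` degree_part I (monom_degree k + d))"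
proof -
  obtain f where f: "f \<in> degree_part I d" "Poly_Mapping.lookup f m \<noteq> 0"
    and max: "\<And>m'. m' \<in> Poly_Mapping.keys f \<Longrightarrow> m' \<le> m"
    using assms(3) unfolding leading_def by (auto simp: in_keys_iff)
  define g where "g = Poly_Mapping.single k (1::'r) * f"
  have keys: "Poly_Mapping.keys g \<subseteq> (+) k ` Poly_Mapping.keys f"
    unfolding g_def by (rule keys_single_mult)
  have "Poly_Mapping.single k (1::'r) \<in> polynomials n"
    using assms(2) unfolding polynomials_def by simp
  then have "g \<in> I"
    using assms(1) f(1) unfolding g_def polynomial_ideal_def degree_part_def by blast
  then have "g \<in> degree_part I (monom_degree k + d)"
    using keys f(1) unfolding degree_part_def by (auto simp: monom_degree_add)
  moreover have "Poly_Mapping.lookup g (k + m) \<noteq> 0"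
    unfolding g_def using f(2) by (simp add: lookup_single_mult)
  moreover have "m' \<le> k + m" if "Poly_Mapping.lookup g m' \<noteq> 0" for m'
    using that keys max by (auto simp: in_keys_iff[symmetric] add_left_mono)
  ultimately show ?thesis unfolding leading_def by blast
qed

text \<open>\<open>Poly_Mapping.nth\<close> reads a list as an exponent vector, with exponent 0
  beyond its length; it is the bridge from lists to monomials.\<close>

lemma keys_nth_subset: "Poly_Mapping.keys (Poly_Mapping.nth xs) \<subseteq> {..<length xs}"
  by (auto simp: in_keys_iff nth_default_def simp del: keys_nth split: if_splits)

lemma monom_degree_nth: "monom_degree (Poly_Mapping.nth xs) = sum_list xs"
proof -
  have "monom_degree (Poly_Mapping.nth xs) =
      (\<Sum>i<length xs. Poly_Mapping.lookup (Poly_Mapping.nth xs) i)"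
    by (intro monom_degree_eq_sum keys_nth_subset) simp
  also have "\<dots> = sum_list xs"
    by (simp add: sum_list_sum_nth nth_default_nth atLeast0LessThan)
  finally show ?thesis .
qed

theorem proposition3p8:
  fixes n :: nat
    and I :: "'r::valuative_semifield mpolynomial set"
  assumes "homogeneous_tropical_ideal n I"
  shows "\<exists>P :: rat poly. \<forall>\<^sub>F d in sequentially.
           of_nat (hilbert_function n I d) = poly P (of_nat d)"
proof -
  \<comment> \<open>The exponent lists of the leading monomials of all degrees together; the degree
    part in question is recovered as \<open>sum_list xs\<close>.\<close>
  define L where "L = {xs. length xs = Suc n \<and>
    Poly_Mapping.nth xs \<in> leading (Poly_Mapping.lookup ` degree_part I (sum_list xs))}"
  have "polynomial_ideal n I"
    using assms unfolding homogeneous_tropical_ideal_def homogeneous_ideal_def by blast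
  have keys_nth: "Poly_Mapping.keys (Poly_Mapping.nth xs) \<subseteq> {0..n}" if "length xs = Suc n"
    for xs :: "nat list"
    using that keys_nth_subset[of xs] by (auto simp del: Poly_Mapping.keys_nth)
  have "ys \<in> L" if "xs \<in> L" "list_all2 (\<le>) xs ys" for xs ys
  proof -
    \<comment> \<open>The quotient of the two monomials; truncated subtraction is exact because
      \<open>xs\<close> is entrywise at most \<open>ys\<close>.\<close>
    define zs where "zs = map2 (-) ys xs"
    have len: "length xs = Suc n" "length ys = Suc n" "length zs = Suc n"
      using that unfolding L_def zs_def by (auto dest: list_all2_lengthD)
    have ys: "Poly_Mapping.nth ys = Poly_Mapping.nth zs + Poly_Mapping.nth xs"
      using that(2) len
      by (intro poly_mapping_eqI)
        (auto simp: lookup_add nth.rep_eq nth_default_def zs_def list_all2_conv_all_nth)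
    then have "sum_list ys = sum_list zs + sum_list xs"
      by (metis monom_degree_nth monom_degree_add)
    moreover have "Poly_Mapping.nth xs \<in> leading (Poly_Mapping.lookup ` degree_part I (sum_list xs))"
      using that(1) unfolding L_def by simp
    ultimately show ?thesis
      using leading_degree_part_add[OF \<open>polynomial_ideal n I\<close> keys_nth[OF len(3)]] len(2)
      unfolding L_def by (simp add: ys monom_degree_nth)
  qed
  then have "up_closed (Suc n) L"
    unfolding up_closed_def L_def by blast
  then have "eventually_poly (\<lambda>d. card (gaps (Suc n) L d))"
    by (rule eventually_poly_card_gaps)
  moreover have "hilbert_function n I d = card (gaps (Suc n) L d)" for d
  proof -
    have "bij_betw Poly_Mapping.nth (gaps (Suc n) L d)
        (monomials n d - leading (Poly_Mapping.lookup ` degree_part I d))"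
      unfolding bij_betw_def
    proof
      \<comment> \<open>Trailing zeros are invisible to \<open>Poly_Mapping.nth\<close>, so
        injectivity rests on the fixed length.\<close>
      show "inj_on Poly_Mapping.nth (gaps (Suc n) L d)"
      proof (rule inj_onI)
        fix xs ys assume "xs \<in> gaps (Suc n) L d" "ys \<in> gaps (Suc n) L d"
          and eq: "Poly_Mapping.nth xs = Poly_Mapping.nth ys"
        then have "length xs = Suc n" "length ys = Suc n" by (auto simp: gaps_def)
        moreover from eq have "nth_default 0 xs i = nth_default 0 ys i" for i
          by (metis nth.rep_eq)
        ultimately show "xs = ys"
          by (metis nth_equalityI nth_default_nth)
      qed
      have gaps_eq: "gaps (Suc n) L d = {xs \<in> {xs. length xs = Suc n \<and> sum_list xs = d}.
          Poly_Mapping.nth xs \<notin> leading (Poly_Mapping.lookup ` degree_part I d)}"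
        by (auto simp: gaps_def L_def)
      have nth_in_monomials: "Poly_Mapping.nth xs \<in> monomials n d"
        if "length xs = Suc n" "sum_list xs = d" for xs
        using that keys_nth[of xs] unfolding monomials_def
        by (simp add: monom_degree_nth del: Poly_Mapping.keys_nth)
      have "m \<in> Poly_Mapping.nth ` {xs. length xs = Suc n \<and> sum_list xs = d}"
        if "m \<in> monomials n d" for m
      proof -
        \<comment> \<open>The exponents of the n+1 variables; no exponent is lost since
          \<open>m\<close> involves only indices up to \<open>n\<close>.\<close>
        define xs where "xs = map (Poly_Mapping.lookup m) [0..<Suc n]"
        have m: "m = Poly_Mapping.nth xs"
          using that unfolding xs_def monomials_def
          by (intro poly_mapping_eqI)
            (auto simp: nth.rep_eq nth_default_def in_keys_iff subset_iff simp del: upt_Suc)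
        moreover have "sum_list xs = d"
          using that m by (simp add: monomials_def flip: monom_degree_nth)
        ultimately show ?thesis unfolding xs_def by auto
      qed
      then show "Poly_Mapping.nth ` gaps (Suc n) L d =
          monomials n d - leading (Poly_Mapping.lookup ` degree_part I d)"
        unfolding gaps_eq using nth_in_monomials by auto
    qed
    then show ?thesis
      unfolding hilbert_function_eq[OF assms] by (simp add: bij_betw_same_card)
  qed
  ultimately show ?thesis unfolding eventually_poly_def by simp
qed

end
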